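(* Let $0<\lambda\le\Lambda$ and let $F:\mathcal{S}(d)\to\mathbb{R}$ be of class $\mathcal{C}^1$ with $F(0)=0$ and $$\lambda\|N\|\le F(M+N)-F(M)\le\Lambda\|N\|\quad\text{for all } M,N\in\mathcal{S}(d)\text{ with } N\ge0.$$ Let $u\in W^{2,1}_{loc}(B_2)$, let $\tilde f$ be a bounded function in $B_2$, and let $m\in L^1(B_2)$ be nonnegative and satisfy, in the weak sense, $$\left(F_{ij}(D^2u)\,m\right)_{x_ix_j}\le\tilde f\quad\text{in } B_2.$$ Then $$\|m\|_{L^1(B_1)}\le C\|m\|_{L^1(B_{1/2})}+C\|\tilde f\|_{L^\infty(B_2)},$$ where the constant $C$ depends only on the ellipticity constants $\lambda,\Lambda$ and on $d$.
   Context: $B_r$ is the open ball of radius $r$ in $\mathbb{R}^d$ centered at the origin. $\mathcal{S}(d)$ is the space of real symmetric $d\times d$ matrices, with a matrix norm $\|\cdot\|$; $N\ge0$ means nonnegative definite. $F_{ij}(M)=\partial F/\partial m_{ij}(M)$, and repeated indices are summed from $1$ to $d$; these satisfy $\lambda|\xi|^2\le F_{ij}(M)\xi_i\xi_j\le\Lambda|\xi|^2$ for all $M\in\mathcal{S}(d)$, $\xi\in\mathbb{R}^d$. The inequality holds in the weak sense if $\int_{B_2}F_{ij}(D^2u)\,m\,\varphi_{x_ix_j}\,dx\le\int_{B_2}\tilde f\varphi\,dx$ for every nonnegative $\varphi\in\mathcal{C}^\infty_c(B_2)$. *)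

theory Defs
  imports "HOL-Analysis.Analysis" "HOL-Probability.Essential_Supremum"
begin

section \<open>Symmetric matrices\<close>

definition sym_mats :: "(real^'n^'n) set" where
  "sym_mats = {M. transpose M = M}"

definition nonneg_def :: "real^'n^'n \<Rightarrow> bool" where
  "nonneg_def N \<longleftrightarrow> N \<in> sym_mats \<and> (\<forall>\<xi>. 0 \<le> \<xi> \<bullet> (N *v \<xi>))"

text \<open>An arbitrary norm on the vector space of symmetric matrices; its values outside
  that space are irrelevant.\<close>

definition sym_mat_norm :: "(real^'n^'n \<Rightarrow> real) \<Rightarrow> bool" where
  "sym_mat_norm nrm \<longleftrightarrow>
     (\<forall>M\<in>sym_mats. 0 \<le> nrm M \<and> (nrm M = 0 \<longleftrightarrow> M = 0)) \<and>
     (\<forall>M\<in>sym_mats. \<forall>c. nrm (c *\<^sub>R M) = \<bar>c\<bar> * nrm M) \<and>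
     (\<forall>M\<in>sym_mats. \<forall>N\<in>sym_mats. nrm (M + N) \<le> nrm M + nrm N)"

definition sym_part :: "real^'n^'n \<Rightarrow> real^'n^'n" where
  "sym_part M = (1 / 2) *\<^sub>R (M + transpose M)"


section \<open>Partial derivatives\<close>

definition dir_deriv :: "('a::real_vector \<Rightarrow> real) \<Rightarrow> 'a \<Rightarrow> 'a \<Rightarrow> real" where
  "dir_deriv f v x = deriv (\<lambda>t. f (x + t *\<^sub>R v)) 0"

text \<open>The matrix \<open>(F\<^sub>i\<^sub>j(M))\<close> of a function \<open>F\<close> of a symmetric matrix. Since the entries of a
  symmetric matrix are not independent, the partial derivative with respect to the entry
  \<open>m\<^sub>i\<^sub>j\<close> is that of \<open>M \<mapsto> F ((M + M\<^sup>T) / 2)\<close>, which is defined on all matrices. This is the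
  convention under which \<open>(F\<^sub>i\<^sub>j(M))\<close> is symmetric and \<open>F\<^sub>i\<^sub>j(M) n\<^sub>i\<^sub>j\<close> is the derivative of \<open>F\<close> at
  \<open>M\<close> in the symmetric direction \<open>N\<close>.\<close>

definition grad_mat :: "(real^'n^'n \<Rightarrow> real) \<Rightarrow> real^'n^'n \<Rightarrow> real^'n^'n" where
  "grad_mat F M = (\<chi> i j. dir_deriv (\<lambda>A. F (sym_part A)) (axis i (axis j 1)) M)"

definition C1_sym :: "(real^'n^'n \<Rightarrow> real) \<Rightarrow> bool" where
  "C1_sym F \<longleftrightarrow> F differentiable_on sym_mats \<and> continuous_on sym_mats (grad_mat F)"

definition elliptic ::
    "(real^'n^'n \<Rightarrow> real) \<Rightarrow> real \<Rightarrow> real \<Rightarrow> (real^'n^'n \<Rightarrow> real) \<Rightarrow> bool" where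
  "elliptic nrm lam Lam F \<longleftrightarrow>
     (\<forall>M\<in>sym_mats. \<forall>N\<in>sym_mats. nonneg_def N \<longrightarrow>
        lam * nrm N \<le> F (M + N) - F M \<and> F (M + N) - F M \<le> Lam * nrm N)"


section \<open>Test functions\<close>

definition iter_partial :: "'n list \<Rightarrow> (real^'n \<Rightarrow> real) \<Rightarrow> real^'n \<Rightarrow> real" where
  "iter_partial is \<phi> = foldr (\<lambda>i \<psi>. dir_deriv \<psi> (axis i 1)) is \<phi>"

text \<open>Requiring Frechet differentiability of all iterated partial derivatives makes them
  all continuous, so this is the usual class of smooth functions.\<close>

definition smooth :: "(real^'n \<Rightarrow> real) \<Rightarrow> bool" where
  "smooth \<phi> \<longleftrightarrow> (\<forall>is. iter_partial is \<phi> differentiable_on UNIV)"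

text \<open>Elements of \<open>C\<^sub>c\<^sup>\<infinity>(\<Omega>)\<close>, extended by zero to the whole space.\<close>

definition test_functions :: "(real^'n) set \<Rightarrow> (real^'n \<Rightarrow> real) set" where
  "test_functions \<Omega> =
     {\<phi>. smooth \<phi> \<and> compact (closure (support_on UNIV \<phi>)) \<and> closure (support_on UNIV \<phi>) \<subseteq> \<Omega>}"


section \<open>Weak derivatives and function spaces\<close>

definition loc_integrable :: "(real^'n) set \<Rightarrow> (real^'n \<Rightarrow> real) \<Rightarrow> bool" where
  "loc_integrable \<Omega> v \<longleftrightarrow> (\<forall>K. compact K \<and> K \<subseteq> \<Omega> \<longrightarrow> integrable (lebesgue_on K) v)"

definition weak_deriv ::
    "(real^'n) set \<Rightarrow> 'n list \<Rightarrow> (real^'n \<Rightarrow> real) \<Rightarrow> (real^'n \<Rightarrow> real) \<Rightarrow> bool" where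
  "weak_deriv \<Omega> is u v \<longleftrightarrow> loc_integrable \<Omega> u \<and> loc_integrable \<Omega> v \<and>
     (\<forall>\<phi>\<in>test_functions \<Omega>.
        (\<integral>x. u x * iter_partial is \<phi> x \<partial>lebesgue_on \<Omega>) =
        (-1) ^ length is * (\<integral>x. v x * \<phi> x \<partial>lebesgue_on \<Omega>))"

text \<open>The local Sobolev space \<open>W\<^sup>k\<^sup>,\<^sup>1\<^sub>l\<^sub>o\<^sub>c(\<Omega>)\<close>.\<close>

definition sobolev_loc :: "nat \<Rightarrow> (real^'n) set \<Rightarrow> (real^'n \<Rightarrow> real) set" where
  "sobolev_loc k \<Omega> =
     {u. loc_integrable \<Omega> u \<and> (\<forall>is. length is \<le> k \<longrightarrow> (\<exists>v. weak_deriv \<Omega> is u v))}"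

text \<open>\<open>H\<close> is a representative of \<open>D\<^sup>2u\<close>, which is determined up to null sets (and symmetric
  almost everywhere).\<close>

definition weak_hessian ::
    "(real^'n) set \<Rightarrow> (real^'n \<Rightarrow> real) \<Rightarrow> (real^'n \<Rightarrow> real^'n^'n) \<Rightarrow> bool" where
  "weak_hessian \<Omega> u H \<longleftrightarrow> (\<forall>i j. weak_deriv \<Omega> [i, j] u (\<lambda>x. H x $ i $ j))"

definition L1_norm :: "(real^'n) set \<Rightarrow> (real^'n \<Rightarrow> real) \<Rightarrow> real" where
  "L1_norm \<Omega> v = (\<integral>x. \<bar>v x\<bar> \<partial>lebesgue_on \<Omega>)"

definition Linf_norm :: "(real^'n) set \<Rightarrow> (real^'n \<Rightarrow> real) \<Rightarrow> real" where
  "Linf_norm \<Omega> v = real_of_ereal (esssup (lebesgue_on \<Omega>) (\<lambda>x. ereal \<bar>v x\<bar>))"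


section \<open>The linearized equation in double divergence form\<close>

text \<open>\<open>(F\<^sub>i\<^sub>j(H) m)\<close> differentiated in \<open>x\<^sub>i\<close>, \<open>x\<^sub>j\<close> and summed is at most \<open>f\<close> in \<open>\<Omega>\<close>, in the weak
  sense.\<close>

definition weak_supersolution ::
    "(real^'n) set \<Rightarrow> (real^'n^'n \<Rightarrow> real) \<Rightarrow> (real^'n \<Rightarrow> real^'n^'n) \<Rightarrow>
     (real^'n \<Rightarrow> real) \<Rightarrow> (real^'n \<Rightarrow> real) \<Rightarrow> bool" where
  "weak_supersolution \<Omega> F H m f \<longleftrightarrow>
     (\<forall>\<phi>\<in>test_functions \<Omega>. (\<forall>x. 0 \<le> \<phi> x) \<longrightarrow>
        (\<integral>x. (\<Sum>i\<in>UNIV. \<Sum>j\<in>UNIV. grad_mat F (H x) $ i $ j * m x * iter_partial [i, j] \<phi> x)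
           \<partial>lebesgue_on \<Omega>)
        \<le> (\<integral>x. f x * \<phi> x \<partial>lebesgue_on \<Omega>))"

end

theory Submission
  imports Defs
begin

text \<open>Test the inequality with the barrier \<open>\<phi>(x) = exp (- K / (2 - |x|\<^sup>2))\<close>, extended by zero. The
  matrices \<open>A = (F\<^sub>i\<^sub>j(D\<^sup>2u))\<close> are uniformly elliptic, so for \<open>K\<close> large, depending only on the
  ellipticity, \<open>A\<^sub>i\<^sub>j \<phi>\<^sub>x\<^sub>i\<^sub>x\<^sub>j\<close> is nonnegative outside \<open>B\<^sub>1\<^sub>/\<^sub>2\<close> and bounded below by some \<open>c > 0\<close> on
  \<open>B\<^sub>1 - B\<^sub>1\<^sub>/\<^sub>2\<close>, while it is bounded on \<open>B\<^sub>1\<^sub>/\<^sub>2\<close>. Hence the mass of \<open>m\<close> in \<open>B\<^sub>1 - B\<^sub>1\<^sub>/\<^sub>2\<close> is controlled by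
  its mass in \<open>B\<^sub>1\<^sub>/\<^sub>2\<close> and by the integral of \<open>f \<phi>\<close>.\<close>

section \<open>A smooth cutoff and its derivatives\<close>

text \<open>The derivatives of \<open>s \<mapsto> exp (- K / s)\<close>, extended by zero to \<open>s \<le> 0\<close>, are linear
  combinations of these functions.\<close>

definition flat :: "real \<Rightarrow> nat \<Rightarrow> real \<Rightarrow> real" where
  "flat K n s = (if 0 < s then exp (- K / s) / s ^ n else 0)"

lemma flat_nonneg: "0 \<le> flat K n s"
  by (simp add: flat_def)

text \<open>Both sides vanish for \<open>s \<le> 0\<close>, so no sign condition is needed. This
  later lets every weight be written with the single factor \<open>flat K 4\<close>.\<close>

lemma flat_mult_power: "flat K (n + k) s * s ^ k = flat K n s"
  by (simp add: flat_def power_add)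

lemma dir_deriv_eq:
  fixes f :: "'a::real_normed_vector \<Rightarrow> real"
  assumes "(f has_derivative D) (at x)"
  shows "dir_deriv f v x = D v"
proof -
  have "((\<lambda>t. x + t *\<^sub>R v) has_derivative (\<lambda>t. t *\<^sub>R v)) (at 0)"
    by (auto intro!: derivative_eq_intros)
  then have "((\<lambda>t. f (x + t *\<^sub>R v)) has_derivative (\<lambda>t. D (t *\<^sub>R v))) (at 0)"
    using has_derivative_compose[of "\<lambda>t. x + t *\<^sub>R v" _ 0 UNIV f D] assms by simp
  moreover have "D (t *\<^sub>R v) = D v * t" for t
    using has_derivative_linear[OF assms] by (simp add: linear_scale)
  ultimately have "((\<lambda>t. f (x + t *\<^sub>R v)) has_field_derivative D v) (at 0)"
    by (simp add: has_field_derivative_def)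
  then show ?thesis unfolding dir_deriv_def by (rule DERIV_imp_deriv)
qed

lemma flat_has_real_derivative:
  assumes "0 < K"
  shows "(flat K n has_real_derivative K * flat K (n + 2) s - n * flat K (n + 1) s) (at s)"
proof -
  consider "0 < s" | "s < 0" | "s = 0" by linarith
  then show ?thesis
  proof cases
    case 1
    have "((\<lambda>s. - K / s) has_real_derivative K / s\<^sup>2) (at s)"
      using DERIV_cmult[OF DERIV_inverse[of s UNIV], of "- K"] 1
      by (simp add: divide_inverse power2_eq_square)
    from DERIV_divide[OF DERIV_fun_exp[OF this] DERIV_pow[of n s]]
    have "((\<lambda>s. exp (- K / s) / s ^ n) has_real_derivative
        (exp (- K / s) * (K / s\<^sup>2) * s ^ n - exp (- K / s) * (n * s ^ (n - 1))) / (s ^ n * s ^ n)) (at s)"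
      using 1 by simp
    \<comment> \<open>The split on \<open>n\<close> handles the truncated exponent
      \<open>n - 1\<close>: at \<open>n = 0\<close> its factor \<open>n\<close> removes the
      term.\<close>
    moreover have "(exp (- K / s) * (K / s\<^sup>2) * s ^ n - exp (- K / s) * (n * s ^ (n - 1))) / (s ^ n * s ^ n) =
        K * flat K (n + 2) s - n * flat K (n + 1) s"
      using 1 by (cases n) (simp_all add: flat_def field_simps power2_eq_square power_add)
    ultimately have "((\<lambda>s. exp (- K / s) / s ^ n) has_real_derivative
        K * flat K (n + 2) s - n * flat K (n + 1) s) (at s)" by simp
    then show ?thesis
      by (rule has_field_derivative_transform_within_open[where S = "{0<..}"])
         (use 1 in \<open>auto simp: flat_def\<close>)
  next
    case 2
    have "((\<lambda>_. 0) has_real_derivative 0) (at s)" by simp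
    then have "(flat K n has_real_derivative 0) (at s)"
      by (rule has_field_derivative_transform_within_open[where S = "{..<0}"])
         (use 2 in \<open>auto simp: flat_def\<close>)
    then show ?thesis using 2 by (simp add: flat_def)
  next
    case 3
    \<comment> \<open>With \<open>y = K / h\<close>, the right difference quotient at 0 is a
      constant multiple of \<open>y ^ Suc n / exp y\<close>, and the exponential beats every power.
      The left quotient is identically 0.\<close>
    have "filterlim (\<lambda>h. K * inverse h) at_top (at_right 0)"
      by (intro filterlim_tendsto_pos_mult_at_top[OF tendsto_const assms] filterlim_inverse_at_top_right)
    then have "((\<lambda>h. (K * inverse h) ^ Suc n / exp (K * inverse h)) \<longlongrightarrow> 0) (at_right 0)"
      by (rule filterlim_compose[OF tendsto_power_div_exp_0])
    then have "((\<lambda>h. inverse K ^ Suc n * ((K * inverse h) ^ Suc n / exp (K * inverse h))) \<longlongrightarrow> 0) (at_right 0)"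
      by (rule tendsto_mult_right_zero)
    moreover have "\<forall>\<^sub>F h in at_right 0.
        inverse K ^ Suc n * ((K * inverse h) ^ Suc n / exp (K * inverse h)) = flat K n h / h"
      using assms by (intro eventually_at_rightI[of 0 1])
        (auto simp: flat_def exp_minus power_mult_distrib field_simps)
    ultimately have r: "((\<lambda>h. flat K n h / h) \<longlongrightarrow> 0) (at_right 0)"
      by (rule Lim_transform_eventually)
    have l: "((\<lambda>h. flat K n h / h) \<longlongrightarrow> 0) (at_left 0)"
      by (rule tendsto_eventually) (auto simp: flat_def intro!: eventually_at_leftI[of "-1" 0])
    have "((\<lambda>h. flat K n h / h) \<longlongrightarrow> 0) (at 0)"
      by (rule filterlim_split_at[OF l r])
    then show ?thesis using 3 by (simp add: DERIV_def flat_def)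
  qed
qed

lemma continuous_on_flat: "0 < K \<Longrightarrow> continuous_on S (flat K n)"
  by (meson DERIV_continuous_on DERIV_subset flat_has_real_derivative subset_UNIV)

text \<open>An algebra containing the barrier and closed under partial derivatives; this is what makes
  the barrier smooth.\<close>

inductive flat_algebra :: "real \<Rightarrow> (real^'n \<Rightarrow> real) \<Rightarrow> bool" for K where
  flat: "flat_algebra K (\<lambda>x. flat K n (2 - x \<bullet> x))"
| const: "flat_algebra K (\<lambda>_. c)"
| coord: "flat_algebra K (\<lambda>x. x $ i)"
| add: "flat_algebra K f \<Longrightarrow> flat_algebra K g \<Longrightarrow> flat_algebra K (\<lambda>x. f x + g x)"
| mult: "flat_algebra K f \<Longrightarrow> flat_algebra K g \<Longrightarrow> flat_algebra K (\<lambda>x. f x * g x)"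

lemma flat_radial_has_derivative:
  assumes "0 < K"
  shows "((\<lambda>x::real^'n. flat K n (2 - x \<bullet> x)) has_derivative
    (\<lambda>h. (K * flat K (n + 2) (2 - x \<bullet> x) - n * flat K (n + 1) (2 - x \<bullet> x)) * (- 2 * (x \<bullet> h)))) (at x)"
proof -
  have 1: "((\<lambda>x::real^'n. 2 - x \<bullet> x) has_derivative (\<lambda>h. - 2 * (x \<bullet> h))) (at x)"
    by (auto intro!: derivative_eq_intros simp: inner_commute)
  show ?thesis
    using has_derivative_compose[OF 1
        flat_has_real_derivative[OF assms, unfolded has_field_derivative_def]]
    by (simp add: mult.commute)
qed

text \<open>Differentiability and closure go through one induction: the sum and product rules for
  \<open>dir_deriv\<close> are available only once both operands are known to be
  differentiable.\<close>

lemma flat_algebra_derivative: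
  fixes f :: "real^'n \<Rightarrow> real"
  assumes "0 < K" "flat_algebra K f"
  shows "f differentiable_on UNIV \<and> flat_algebra K (dir_deriv f (axis i 1))"
  using assms(2)
proof induction
  case (flat n)
  have "dir_deriv (\<lambda>x::real^'n. flat K n (2 - x \<bullet> x)) (axis i 1) = (\<lambda>x. (K * flat K (n + 2) (2 - x \<bullet> x)
      + (- n) * flat K (n + 1) (2 - x \<bullet> x)) * (- 2 * x $ i))"
    by (rule ext, subst dir_deriv_eq[OF flat_radial_has_derivative[OF assms(1)]])
       (simp add: inner_axis)
  moreover have "flat_algebra K (\<lambda>x. (K * flat K (n + 2) (2 - x \<bullet> x)
      + (- n) * flat K (n + 1) (2 - x \<bullet> x)) * (- 2 * x $ i))"
    by (intro flat_algebra.intros)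
  ultimately show ?case
    using flat_radial_has_derivative[OF assms(1)]
    by (auto simp: differentiable_on_def differentiable_def)
next
  case (const c)
  have "dir_deriv (\<lambda>_::real^'n. c) (axis i 1) = (\<lambda>_. 0)"
    by (simp add: dir_deriv_def fun_eq_iff)
  then show ?case by (simp add: flat_algebra.const)
next
  case (coord j)
  have d: "((\<lambda>x::real^'n. x $ j) has_derivative (\<lambda>h. h $ j)) (at x)" for x
    by (rule bounded_linear_imp_has_derivative[OF bounded_linear_vec_nth])
  have "dir_deriv (\<lambda>x::real^'n. x $ j) (axis i 1) = (\<lambda>_. axis i 1 $ j)"
    by (rule ext) (simp add: dir_deriv_eq[OF d])
  then show ?case
    using d by (auto simp: differentiable_on_def differentiable_def flat_algebra.const)
next
  case (add f g)
  have df: "(f has_derivative frechet_derivative f (at x)) (at x)"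
    and dg: "(g has_derivative frechet_derivative g (at x)) (at x)" for x
    using add.IH by (auto simp: differentiable_on_def frechet_derivative_works)
  have "dir_deriv (\<lambda>x. f x + g x) (axis i 1) =
      (\<lambda>x. dir_deriv f (axis i 1) x + dir_deriv g (axis i 1) x)"
    by (rule ext) (simp add: dir_deriv_eq[OF has_derivative_add[OF df dg]] dir_deriv_eq[OF df] dir_deriv_eq[OF dg])
  then show ?case
    using add.IH by (auto intro: differentiable_on_add flat_algebra.add)
next
  case (mult f g)
  have df: "(f has_derivative frechet_derivative f (at x)) (at x)"
    and dg: "(g has_derivative frechet_derivative g (at x)) (at x)" for x
    using mult.IH by (auto simp: differentiable_on_def frechet_derivative_works)
  have "dir_deriv (\<lambda>x. f x * g x) (axis i 1) =
      (\<lambda>x. f x * dir_deriv g (axis i 1) x + dir_deriv f (axis i 1) x * g x)"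
    by (rule ext) (simp add: dir_deriv_eq[OF has_derivative_mult[OF df dg]] dir_deriv_eq[OF df] dir_deriv_eq[OF dg])
  then show ?case
    using mult by (auto intro!: differentiable_on_mult flat_algebra.intros)
qed

lemma flat_algebra_smooth:
  assumes "0 < K" "flat_algebra K f"
  shows "smooth f"
proof -
  have "flat_algebra K (iter_partial is f)" for "is"
    by (induction "is") (use flat_algebra_derivative[OF assms(1)] assms(2) in \<open>auto simp: iter_partial_def\<close>)
  then show ?thesis
    unfolding smooth_def using flat_algebra_derivative[OF assms(1)] by blast
qed

text \<open>The support lies in the closed ball of radius \<open>sqrt 2\<close>. A radius strictly
  between 1 and 2 keeps the support compact inside the domain while the barrier stays bounded away
  from zero on the unit ball.\<close>

lemma flat_test_function:
  assumes "0 < K"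
  shows "(\<lambda>x::real^'n. flat K 0 (2 - x \<bullet> x)) \<in> test_functions (ball 0 2)"
proof -
  let ?S = "support_on UNIV (\<lambda>x::real^'n. flat K 0 (2 - x \<bullet> x))"
  have "?S \<subseteq> cball 0 (sqrt 2)"
    by (auto simp: support_on_def flat_def norm_eq_sqrt_inner split: if_splits)
  then have "closure ?S \<subseteq> cball 0 (sqrt 2)"
    by (simp add: closure_minimal)
  moreover have "cball 0 (sqrt 2) \<subseteq> (ball 0 2 :: (real^'n) set)"
    using real_sqrt_less_mono[of 2 4] by auto
  ultimately show ?thesis
    unfolding test_functions_def
    by (auto intro: flat_algebra_smooth[OF assms] flat_algebra.flat
        bounded_subset[OF bounded_cball] simp: compact_eq_bounded_closed)
qed

text \<open>Factoring out \<open>flat K 4 s\<close> leaves a combination of the rank-one matrix of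
  \<open>x\<close> and the identity, so the coefficients need to be controlled against these two
  matrices only. The rank-one term carries the large parameter \<open>K\<close>.\<close>

lemma flat_second_partial:
  assumes "0 < K"
  shows "iter_partial [i, j] (\<lambda>x::real^'n. flat K 0 (2 - x \<bullet> x)) x =
    (let s = 2 - x \<bullet> x in
      2 * K * flat K 4 s * (2 * (K - 2 * s) * (x $ i * x $ j) - s\<^sup>2 * mat 1 $ i $ j))"
proof -
  define s where "s = 2 - x \<bullet> x"
  have *: "dir_deriv (\<lambda>x::real^'n. flat K 0 (2 - x \<bullet> x)) (axis j 1) =
      (\<lambda>x. flat K 2 (2 - x \<bullet> x) * (- 2 * K * x $ j))"
    by (rule ext, subst dir_deriv_eq[OF flat_radial_has_derivative[OF assms]])
       (simp add: inner_axis numeral_2_eq_2)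
  have "((\<lambda>x::real^'n. x $ j) has_derivative (\<lambda>h. h $ j)) (at x)"
    by (rule bounded_linear_imp_has_derivative[OF bounded_linear_vec_nth])
  then have c: "((\<lambda>x::real^'n. - 2 * K * x $ j) has_derivative (\<lambda>h. - 2 * K * h $ j)) (at x)"
    by (rule has_derivative_mult_right)
  have "iter_partial [i, j] (\<lambda>x::real^'n. flat K 0 (2 - x \<bullet> x)) x =
      flat K 2 s * (- 2 * K * axis i 1 $ j) +
      (K * flat K 4 s - 2 * flat K 3 s) * (- 2 * x $ i) * (- 2 * K * x $ j)"
    unfolding iter_partial_def foldr.simps o_def * id_def
    by (subst dir_deriv_eq[OF has_derivative_mult[OF flat_radial_has_derivative[OF assms] c]])
       (simp add: inner_axis s_def)
  also have "flat K 2 s = flat K 4 s * s\<^sup>2"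
    using flat_mult_power[of K 2 2 s] by simp
  also have "flat K 3 s = flat K 4 s * s"
    using flat_mult_power[of K 3 1 s] by simp
  finally show ?thesis
    by (auto simp: Let_def s_def[symmetric] mat_def axis_def algebra_simps)
qed

section \<open>Ellipticity of the linearized coefficients\<close>

lemma sym_part_in_sym_mats: "sym_part M \<in> sym_mats"
  by (simp add: sym_part_def sym_mats_def transpose_def vec_eq_iff add.commute)

lemma sym_part_id: "M \<in> sym_mats \<Longrightarrow> sym_part M = M"
  by (auto simp: sym_part_def sym_mats_def scaleR_2[symmetric])

lemma linear_sym_part: "linear (sym_part :: real^'n^'n \<Rightarrow> _)"
  by (rule linearI)
     (auto simp: sym_part_def transpose_def vec_eq_iff algebra_simps)

text \<open>\<open>F\<close> is differentiable only along the subspace of symmetric matrices;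
  composing it with the linear projection \<open>sym_part\<close> gives a derivative on the full
  space, read off on matrix units. \<open>M\<close> is arbitrary because a representative of the
  Hessian is symmetric only almost everywhere.\<close>

lemma has_derivative_grad_mat:
  fixes F :: "real^'n^'n \<Rightarrow> real"
  assumes "F differentiable_on sym_mats"
  shows "((\<lambda>A. F (sym_part A)) has_derivative
    (\<lambda>N. grad_mat F M \<bullet> N)) (at M)"
proof -
  obtain D where D: "(F has_derivative D) (at (sym_part M) within sym_mats)"
    using assms sym_part_in_sym_mats unfolding differentiable_on_def differentiable_def by blast
  have "(sym_part has_derivative sym_part) (at M)"
    by (rule bounded_linear_imp_has_derivative[OF linear_conv_bounded_linear[THEN iffD1, OF linear_sym_part]])
  moreover have "(F has_derivative D) (at (sym_part M) within range sym_part)"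
    by (rule has_derivative_subset[OF D]) (auto intro: sym_part_in_sym_mats)
  ultimately have *: "((\<lambda>A. F (sym_part A)) has_derivative (\<lambda>N. D (sym_part N))) (at M)"
    using diff_chain_within[of sym_part sym_part M UNIV F D] by (simp add: o_def)
  have lin: "linear (\<lambda>N. D (sym_part N))"
    using has_derivative_linear[OF *] .
  have "D (sym_part N) = grad_mat F M \<bullet> N" for N
  proof -
    have "N = (\<Sum>i\<in>UNIV. \<Sum>j\<in>UNIV. N $ i $ j *\<^sub>R axis i (axis j 1))"
    proof -
      have "(\<Sum>j\<in>UNIV. N $ i $ j *\<^sub>R axis i (axis j 1) $ k $ l) = (if k = i then N $ k $ l else 0)" for i k l
        by (cases "k = i") (simp_all add: axis_def if_distrib[where f = "(*) _"] cong: if_cong)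
      then show ?thesis
        by (subst vec_eq_iff, subst vec_eq_iff) (simp add: sum_component)
    qed
    then have "D (sym_part N) = D (sym_part (\<Sum>i\<in>UNIV. \<Sum>j\<in>UNIV. N $ i $ j *\<^sub>R axis i (axis j 1)))"
      by (rule arg_cong[where f = "\<lambda>N. D (sym_part N)"])
    also have "\<dots> = (\<Sum>i\<in>UNIV. \<Sum>j\<in>UNIV. N $ i $ j *\<^sub>R D (sym_part (axis i (axis j 1))))"
      using lin by (simp add: linear_sum[OF lin] linear_scale[OF lin])
    finally show ?thesis
      by (simp add: inner_vec_def grad_mat_def dir_deriv_eq[OF *] mult.commute)
  qed
  then show ?thesis using * by simp
qed

text \<open>Divide the ellipticity inequalities for the increment \<open>t *\<^sub>R N\<close> by
  \<open>t\<close> and let \<open>t\<close> tend to 0. The limit is taken from the right, since the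
  increment must stay nonnegative definite.\<close>

lemma grad_mat_bounds:
  assumes "sym_mat_norm nrm" "C1_sym F" "elliptic nrm lam Lam F" "nonneg_def N"
  shows "lam * nrm N \<le> grad_mat F M \<bullet> N"
    and "grad_mat F M \<bullet> N \<le> Lam * nrm N"
proof -
  define D where "D N = grad_mat F M \<bullet> N" for N
  have d: "((\<lambda>A. F (sym_part A)) has_derivative D) (at M)"
    unfolding D_def using assms(2) by (intro has_derivative_grad_mat) (simp add: C1_sym_def)
  have "((\<lambda>t. M + t *\<^sub>R N) has_derivative (\<lambda>t. t *\<^sub>R N)) (at 0)"
    by (auto intro!: derivative_eq_intros)
  then have "((\<lambda>t. F (sym_part (M + t *\<^sub>R N))) has_derivative (\<lambda>t. D (t *\<^sub>R N))) (at 0)"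
    using has_derivative_compose[of "\<lambda>t. M + t *\<^sub>R N" _ 0 UNIV _ D] d by simp
  moreover have "(\<lambda>t. D (t *\<^sub>R N)) = (*) (D N)"
    using linear_scale[OF has_derivative_linear[OF d]] by (auto simp: mult.commute)
  ultimately have "((\<lambda>t. F (sym_part (M + t *\<^sub>R N))) has_field_derivative D N) (at 0)"
    by (simp add: has_field_derivative_def)
  then have "((\<lambda>t. (F (sym_part (M + t *\<^sub>R N)) - F (sym_part M)) / t) \<longlongrightarrow> D N) (at 0)"
    by (simp add: DERIV_def)
  then have lim: "((\<lambda>t. (F (sym_part (M + t *\<^sub>R N)) - F (sym_part M)) / t) \<longlongrightarrow> D N) (at_right 0)"
    by (rule filterlim_mono) (auto intro: at_le)
  have N: "N \<in> sym_mats" using assms(4) by (simp add: nonneg_def_def)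
  have q: "lam * nrm N \<le> (F (sym_part (M + t *\<^sub>R N)) - F (sym_part M)) / t \<and>
      (F (sym_part (M + t *\<^sub>R N)) - F (sym_part M)) / t \<le> Lam * nrm N" if "0 < t" for t
  proof -
    have tN: "t *\<^sub>R N \<in> sym_mats"
      using N by (simp add: sym_mats_def transpose_def vec_eq_iff)
    have "0 \<le> \<xi> \<bullet> ((t *\<^sub>R N) *v \<xi>)" for \<xi>
      using assms(4) that by (simp add: nonneg_def_def scaleR_matrix_vector_assoc[symmetric])
    with tN have "nonneg_def (t *\<^sub>R N)" by (simp add: nonneg_def_def)
    moreover have "sym_part (M + t *\<^sub>R N) = sym_part M + t *\<^sub>R N"
      by (simp add: linear_add[OF linear_sym_part] sym_part_id[OF tN])
    moreover have "nrm (t *\<^sub>R N) = t * nrm N"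
      using assms(1) N that by (simp add: sym_mat_norm_def)
    ultimately have "lam * (t * nrm N) \<le> F (sym_part (M + t *\<^sub>R N)) - F (sym_part M)"
      "F (sym_part (M + t *\<^sub>R N)) - F (sym_part M) \<le> Lam * (t * nrm N)"
      using assms(3) tN sym_part_in_sym_mats[of M] unfolding elliptic_def by metis+
    then show ?thesis using that by (simp add: field_simps)
  qed
  have ev: "\<forall>\<^sub>F t in at_right 0. (0::real) < t"
    by (rule eventually_at_right_less)
  have "lam * nrm N \<le> D N"
    by (rule tendsto_lowerbound[OF lim]) (use ev q in \<open>auto elim: eventually_mono\<close>)
  moreover have "D N \<le> Lam * nrm N"
    by (rule tendsto_upperbound[OF lim]) (use ev q in \<open>auto elim: eventually_mono\<close>)
  ultimately show "lam * nrm N \<le> grad_mat F M \<bullet> N"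
    and "grad_mat F M \<bullet> N \<le> Lam * nrm N"
    by (simp_all add: D_def)
qed

text \<open>\<open>grad_mat F M\<close> depends on \<open>M\<close> only through
  \<open>sym_part M\<close>, so continuity extends from the symmetric matrices to all. This yields
  measurability of the coefficients along the Hessian.\<close>

lemma continuous_on_grad_mat:
  fixes F :: "real^'n^'n \<Rightarrow> real"
  assumes "C1_sym F"
  shows "continuous_on UNIV (grad_mat F)"
proof -
  have "sym_part (sym_part M + t *\<^sub>R E) = sym_part (M + t *\<^sub>R E)" for M E :: "real^'n^'n" and t
    by (simp add: linear_add[OF linear_sym_part] sym_part_id sym_part_in_sym_mats)
  then have eq: "grad_mat F = (\<lambda>M. grad_mat F (sym_part M))"
    by (simp add: grad_mat_def dir_deriv_def fun_eq_iff)
  have "continuous_on sym_mats (grad_mat F)"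
    using assms by (simp add: C1_sym_def)
  moreover have "continuous_on UNIV (sym_part :: real^'n^'n \<Rightarrow> _)"
    by (rule linear_continuous_on[OF linear_conv_bounded_linear[THEN iffD1, OF linear_sym_part]])
  ultimately have "continuous_on UNIV (\<lambda>M. grad_mat F (sym_part M))"
    by (rule continuous_on_compose2) (auto intro: sym_part_in_sym_mats)
  then show ?thesis
    by (subst eq)
qed

text \<open>In the entrywise inner product, \<open>A \<bullet> outer x\<close> is the quadratic form
  of \<open>A\<close> at \<open>x\<close>.\<close>

definition outer :: "real^'n \<Rightarrow> real^'n^'n" where
  "outer x = (\<chi> i j. x $ i * x $ j)"

lemma outer_quadratic_form: "\<xi> \<bullet> (outer x *v \<xi>) = (x \<bullet> \<xi>)\<^sup>2"
proof -
  have "outer x *v \<xi> = (x \<bullet> \<xi>) *\<^sub>R x"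
    by (simp add: outer_def matrix_vector_mult_def vec_eq_iff inner_vec_def sum_distrib_left
        sum_distrib_right mult_ac)
  then show ?thesis by (simp add: power2_eq_square inner_commute)
qed

lemma outer_sym: "outer x \<in> sym_mats"
  by (simp add: sym_mats_def outer_def transpose_def vec_eq_iff)

lemma mat_1_sym: "(mat 1 :: real^'n^'n) \<in> sym_mats"
  by (simp add: sym_mats_def)

text \<open>The norm is continuous, so on the compact unit sphere \<open>nrm (outer x)\<close>
  attains a minimum, which is positive because \<open>outer x\<close> is nonzero there. Homogeneity
  of degree 2 extends the bound to all \<open>x\<close>.\<close>

lemma sym_mat_norm_outer_ge:
  fixes nrm :: "real^'n^'n \<Rightarrow> real"
  assumes "sym_mat_norm nrm"
  obtains c where "0 < c" "\<And>x::real^'n. c * (x \<bullet> x) \<le> nrm (outer x)"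
proof -
  note n = assms[unfolded sym_mat_norm_def]
  have sc: "sym_part (a *\<^sub>R A) = a *\<^sub>R sym_part A" for a and A :: "real^'n^'n"
    by (rule linear_scale[OF linear_sym_part])
  \<comment> \<open>Nothing is known of \<open>nrm\<close> off the symmetric matrices, hence the
    composition with \<open>sym_part\<close>; a convex function on a finite-dimensional space is
    continuous.\<close>
  have "convex_on UNIV (\<lambda>M. nrm (sym_part M))"
  proof (rule convex_onI)
    fix t :: real and A B :: "real^'n^'n" assume t: "0 < t" "t < 1"
    have "nrm (sym_part ((1 - t) *\<^sub>R A + t *\<^sub>R B)) = nrm (sym_part ((1 - t) *\<^sub>R A) + sym_part (t *\<^sub>R B))"
      by (simp add: linear_add[OF linear_sym_part])
    also have "\<dots> \<le> nrm (sym_part ((1 - t) *\<^sub>R A)) + nrm (sym_part (t *\<^sub>R B))"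
      using n sym_part_in_sym_mats by blast
    also have "\<dots> = (1 - t) * nrm (sym_part A) + t * nrm (sym_part B)"
      using n sym_part_in_sym_mats[of A] sym_part_in_sym_mats[of B] t by (simp add: sc)
    finally show "nrm (sym_part ((1 - t) *\<^sub>R A + t *\<^sub>R B)) \<le> (1 - t) * nrm (sym_part A) + t * nrm (sym_part B)" .
  qed simp
  then have "continuous_on UNIV (\<lambda>M. nrm (sym_part M))"
    by (intro convex_on_continuous) auto
  moreover have "continuous_on (sphere 0 1) (outer :: real^'n \<Rightarrow> _)"
    unfolding outer_def by (intro continuous_intros)
  ultimately have "continuous_on (sphere 0 1) (\<lambda>x::real^'n. nrm (sym_part (outer x)))"
    by (rule continuous_on_compose2) auto
  then have cont: "continuous_on (sphere 0 1) (\<lambda>x::real^'n. nrm (outer x))"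
    by (simp add: sym_part_id outer_sym)
  have "sphere (0::real^'n) 1 \<noteq> {}" by simp
  then obtain y :: "real^'n" where y: "norm y = 1" "\<And>x. norm x = 1 \<Longrightarrow> nrm (outer y) \<le> nrm (outer x)"
    using continuous_attains_inf[OF compact_sphere _ cont] by auto
  have "y \<bullet> (outer y *v y) = 1"
    using y(1) by (simp add: outer_quadratic_form dot_square_norm)
  then have "outer y \<noteq> 0" by auto
  then have pos: "0 < nrm (outer y)"
    using n outer_sym[of y] by (metis order_le_less)
  have "nrm (outer y) * (x \<bullet> x) \<le> nrm (outer x)" for x :: "real^'n"
  proof (cases "x = 0")
    case True
    then show ?thesis using n outer_sym[of x] by simp
  next
    case False
    define z where "z = x /\<^sub>R norm x"
    have "norm z = 1" using False by (simp add: z_def)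
    have "x = norm x *\<^sub>R z" using False by (simp add: z_def)
    then have "outer x = outer (norm x *\<^sub>R z)" by (rule arg_cong)
    also have "\<dots> = (x \<bullet> x) *\<^sub>R outer z"
      by (simp add: outer_def vec_eq_iff dot_square_norm power2_eq_square)
    finally have "outer x = (x \<bullet> x) *\<^sub>R outer z" .
    then have "nrm (outer x) = (x \<bullet> x) * nrm (outer z)"
      using n outer_sym[of z] by simp
    then show ?thesis using y(2)[OF \<open>norm z = 1\<close>]
      by (simp add: mult.commute mult_left_mono)
  qed
  with pos show ?thesis using that by blast
qed

lemma nonneg_def_outer: "nonneg_def (outer x)"
  by (simp add: nonneg_def_def outer_sym outer_quadratic_form)

lemma nonneg_def_mat_1: "nonneg_def (mat 1 :: real^'n^'n)"
  by (simp add: nonneg_def_def mat_1_sym)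

text \<open>This is Cauchy-Schwarz. Pairing with it bounds the quadratic form of the coefficients at
  \<open>x\<close> by their trace times \<open>x \<bullet> x\<close>.\<close>

lemma nonneg_def_outer_complement: "nonneg_def ((x \<bullet> x) *\<^sub>R mat 1 - outer x)"
proof -
  have "(x \<bullet> x) *\<^sub>R mat 1 - outer x \<in> sym_mats"
    by (simp add: sym_mats_def outer_def transpose_def vec_eq_iff mat_def)
  moreover have "((x \<bullet> x) *\<^sub>R mat 1 - outer x) *v \<xi> = (x \<bullet> x) *\<^sub>R \<xi> - outer x *v \<xi>" for \<xi>
    by (simp add: matrix_vector_mult_diff_rdistrib scaleR_matrix_vector_assoc[symmetric])
  ultimately show ?thesis
    using Cauchy_Schwarz_ineq[of x]
    by (simp add: nonneg_def_def inner_diff_right outer_quadratic_form)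
qed

text \<open>The constants are fixed before \<open>F\<close> and \<open>M\<close>, which is what
  makes the final constant uniform. The lower one comes from the size of \<open>outer x\<close>, and
  the upper one bounds the trace and, through the trace, the quadratic form.\<close>

lemma elliptic_quadratic_form_bounds:
  fixes nrm :: "real^'n^'n \<Rightarrow> real"
  assumes "sym_mat_norm nrm" "0 < lam" "lam \<le> Lam"
  obtains a b where "0 < a" "0 \<le> b"
    "\<And>F M (x::real^'n). C1_sym F \<Longrightarrow> elliptic nrm lam Lam F \<Longrightarrow>
      a * (x \<bullet> x) \<le> grad_mat F M \<bullet> outer x \<and> grad_mat F M \<bullet> outer x \<le> b * (x \<bullet> x) \<and>
      0 \<le> grad_mat F M \<bullet> mat 1 \<and> grad_mat F M \<bullet> mat 1 \<le> b"
proof -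
  obtain c where c: "0 < c" "\<And>x::real^'n. c * (x \<bullet> x) \<le> nrm (outer x)"
    using sym_mat_norm_outer_ge[OF assms(1)] by blast
  have n: "0 \<le> nrm N" if "nonneg_def N" for N
    using assms(1) that by (simp add: sym_mat_norm_def nonneg_def_def)
  let ?b = "Lam * nrm (mat 1)"
  show ?thesis
  proof (rule that[of "lam * c" ?b])
    show "0 < lam * c" "0 \<le> ?b"
      using assms(2,3) c(1) n[OF nonneg_def_mat_1] by auto
    fix F :: "real^'n^'n \<Rightarrow> real" and M and x :: "real^'n"
    assume F: "C1_sym F" "elliptic nrm lam Lam F"
    note B = grad_mat_bounds[OF assms(1) F]
    have pos: "0 \<le> grad_mat F M \<bullet> N" if "nonneg_def N" for N
      using B(1)[OF that, of M] n[OF that] assms(2) by (smt (verit) mult_nonneg_nonneg)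
    have tr: "grad_mat F M \<bullet> mat 1 \<le> ?b"
      using B(2)[OF nonneg_def_mat_1] .
    have "lam * c * (x \<bullet> x) \<le> lam * nrm (outer x)"
      using c(2)[of x] assms(2) by (simp add: mult.assoc)
    also have "\<dots> \<le> grad_mat F M \<bullet> outer x"
      using B(1)[OF nonneg_def_outer] .
    finally have "lam * c * (x \<bullet> x) \<le> grad_mat F M \<bullet> outer x" .
    moreover have "grad_mat F M \<bullet> outer x \<le> (grad_mat F M \<bullet> mat 1) * (x \<bullet> x)"
      using pos[OF nonneg_def_outer_complement[of x]] by (simp add: inner_diff_right mult.commute)
    then have "grad_mat F M \<bullet> outer x \<le> ?b * (x \<bullet> x)"
      using mult_right_mono[OF tr, of "x \<bullet> x"] by simp
    ultimately show "lam * c * (x \<bullet> x) \<le> grad_mat F M \<bullet> outer x \<and>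
        grad_mat F M \<bullet> outer x \<le> ?b * (x \<bullet> x) \<and>
        0 \<le> grad_mat F M \<bullet> mat 1 \<and> grad_mat F M \<bullet> mat 1 \<le> ?b"
      using tr pos[OF nonneg_def_mat_1] by simp
  qed
qed

section \<open>The barrier\<close>

text \<open>The value of \<open>A\<^sub>i\<^sub>j \<phi>\<^sub>x\<^sub>i\<^sub>x\<^sub>j\<close> for the barrier \<open>\<phi>\<close>.\<close>

definition barrier_operator :: "real \<Rightarrow> real^'n^'n \<Rightarrow> real^'n \<Rightarrow> real" where
  "barrier_operator K A x = (let s = 2 - x \<bullet> x in
    2 * K * flat K 4 s * (2 * (K - 2 * s) * (A \<bullet> outer x) - s\<^sup>2 * (A \<bullet> mat 1)))"

lemma sum_second_partials_barrier:
  assumes "0 < K"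
  shows "(\<Sum>i\<in>UNIV. \<Sum>j\<in>UNIV. A $ i $ j * m *
      iter_partial [i, j] (\<lambda>x::real^'n. flat K 0 (2 - x \<bullet> x)) x) = barrier_operator K A x * m"
proof -
  define s where "s = 2 - x \<bullet> x"
  let ?N = "(2 * (K - 2 * s)) *\<^sub>R outer x - s\<^sup>2 *\<^sub>R mat 1"
  have "A $ i $ j * m * iter_partial [i, j] (\<lambda>x::real^'n. flat K 0 (2 - x \<bullet> x)) x =
      (2 * K * flat K 4 s * m) * (A $ i $ j * ?N $ i $ j)" for i j
    by (simp add: flat_second_partial[OF assms] Let_def outer_def s_def[symmetric])
  then have "(\<Sum>i\<in>UNIV. \<Sum>j\<in>UNIV. A $ i $ j * m *
      iter_partial [i, j] (\<lambda>x::real^'n. flat K 0 (2 - x \<bullet> x)) x) =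
      (2 * K * flat K 4 s * m) * (\<Sum>i\<in>UNIV. \<Sum>j\<in>UNIV. A $ i $ j * ?N $ i $ j)"
    by (simp only: sum_distrib_left)
  also have "(\<Sum>i\<in>UNIV. \<Sum>j\<in>UNIV. A $ i $ j * ?N $ i $ j) = A \<bullet> ?N"
    by (simp add: inner_vec_def)
  finally show ?thesis
    by (simp add: barrier_operator_def Let_def s_def inner_diff_right)
qed

lemma barrier_operator_lower:
  fixes x :: "real^'n"
  assumes a: "0 < a" and b: "0 \<le> b" and K: "K = 4 + (8 * b + 2) / a"
    and A: "a * (x \<bullet> x) \<le> A \<bullet> outer x" "A \<bullet> mat 1 \<le> b"
    and x: "1 / 4 \<le> x \<bullet> x"
  shows "0 \<le> barrier_operator K A x"
    and "x \<bullet> x \<le> 1 \<Longrightarrow> K * exp (- K) / 8 \<le> barrier_operator K A x"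
proof -
  define s where "s = 2 - x \<bullet> x"
  define Q where "Q = 2 * (K - 2 * s) * (A \<bullet> outer x) - s\<^sup>2 * (A \<bullet> mat 1)"
  have K4: "4 < K" using a b by (simp add: K)
  have L: "barrier_operator K A x = 2 * K * flat K 4 s * Q"
    by (simp add: barrier_operator_def Let_def s_def Q_def)
  have Q: "1 \<le> Q" if s: "0 < s"
  proof -
    have s2: "s \<le> 2" using x by (simp add: s_def)
    have "a / 4 \<le> a * (x \<bullet> x)"
      using a x by simp
    with A(1) have 1: "a / 4 \<le> A \<bullet> outer x" by linarith
    \<comment> \<open>This dictates the choice of \<open>K\<close>: since \<open>s \<le> 2\<close>,
      the rank-one term is at least \<open>2 * (K - 4) * (a / 4)\<close> and the trace term at most
      \<open>4 * b\<close>, leaving a surplus of 1.\<close>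
    have "4 * b + 1 = (K - 4) * (a / 2)"
      using a by (simp add: K field_simps)
    also have "\<dots> = 2 * (K - 4) * (a / 4)" by simp
    also have "\<dots> \<le> 2 * (K - 2 * s) * (A \<bullet> outer x)"
      using 1 K4 s2 a by (intro mult_mono) auto
    finally have "4 * b + 1 \<le> 2 * (K - 2 * s) * (A \<bullet> outer x)" .
    moreover have "s\<^sup>2 * (A \<bullet> mat 1) \<le> 4 * b"
    proof -
      have "s\<^sup>2 * (A \<bullet> mat 1) \<le> s\<^sup>2 * b" using A(2) by (simp add: mult_left_mono)
      also have "\<dots> \<le> 4 * b"
        using power_mono[of s 2 2] s s2 b by (intro mult_right_mono) auto
      finally show ?thesis .
    qed
    ultimately show ?thesis by (simp add: Q_def)
  qed
  show "0 \<le> barrier_operator K A x"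
  proof (cases "0 < s")
    case True
    then show ?thesis using Q K4 flat_nonneg[of K 4 s] by (simp add: L)
  next
    case False
    then show ?thesis by (simp add: L flat_def)
  qed
  show "K * exp (- K) / 8 \<le> barrier_operator K A x" if "x \<bullet> x \<le> 1"
  proof -
    \<comment> \<open>On this range \<open>flat K 4 s\<close> is at least
      \<open>exp (- K) / 16\<close>; the prefactor \<open>2 * K\<close> turns this into the stated
      constant.\<close>
    have s: "1 \<le> s" "s \<le> 2" using that x by (simp_all add: s_def)
    have "K / s \<le> K" using s K4 by (simp add: field_simps)
    then have "exp (- K) \<le> exp (- K / s)" by simp
    moreover have "s ^ 4 \<le> 16" using power_mono[of s 2 4] s by simp
    ultimately have "exp (- K) / 16 \<le> exp (- K / s) / s ^ 4"
      using s by (intro frac_le) auto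
    then have "exp (- K) / 16 \<le> flat K 4 s"
      using s by (simp add: flat_def)
    then have "2 * K * (exp (- K) / 16) \<le> 2 * K * flat K 4 s"
      using K4 by (intro mult_left_mono) auto
    also have "\<dots> \<le> 2 * K * flat K 4 s * Q"
      using mult_left_mono[OF Q, of "2 * K * flat K 4 s"] s K4 flat_nonneg[of K 4 s] by simp
    finally show ?thesis by (simp add: L)
  qed
qed

text \<open>The weight vanishes for \<open>s \<le> 0\<close> and is continuous on the compact
  interval from 0 to 2, hence bounded; the remaining factor is bounded by ellipticity. Since
  \<open>B\<close> does not depend on \<open>A\<close>, it serves all admissible
  coefficients.\<close>

lemma barrier_operator_bounded:
  assumes "4 < K" "0 \<le> b"
  obtains B where "0 \<le> B"
    "\<And>A (x::real^'n). 0 \<le> A \<bullet> outer x \<Longrightarrow> A \<bullet> outer x \<le> b * (x \<bullet> x) \<Longrightarrow>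
      0 \<le> A \<bullet> mat 1 \<Longrightarrow> A \<bullet> mat 1 \<le> b \<Longrightarrow> \<bar>barrier_operator K A x\<bar> \<le> B"
proof -
  have "compact (flat K 4 ` {0..2})"
    using assms(1) by (intro compact_continuous_image continuous_on_flat) auto
  then obtain e where e: "\<And>s. s \<in> {0..2} \<Longrightarrow> \<bar>flat K 4 s\<bar> \<le> e"
    using compact_imp_bounded bounded_real by (metis image_eqI)
  have e0: "0 \<le> e" using e[of 0] by simp
  show ?thesis
  proof (rule that[of "2 * K * e * (4 * K * b + 4 * b)"])
    show "0 \<le> 2 * K * e * (4 * K * b + 4 * b)" using assms e0 by simp
    fix A and x :: "real^'n"
    assume A: "0 \<le> A \<bullet> outer x" "A \<bullet> outer x \<le> b * (x \<bullet> x)" "0 \<le> A \<bullet> mat 1" "A \<bullet> mat 1 \<le> b"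
    define s where "s = 2 - x \<bullet> x"
    define Q where "Q = 2 * (K - 2 * s) * (A \<bullet> outer x) - s\<^sup>2 * (A \<bullet> mat 1)"
    have L: "barrier_operator K A x = 2 * K * flat K 4 s * Q"
      by (simp add: barrier_operator_def Let_def s_def Q_def)
    show "\<bar>barrier_operator K A x\<bar> \<le> 2 * K * e * (4 * K * b + 4 * b)"
    proof (cases "0 < s")
      case False
      then show ?thesis using assms e0 by (simp add: L flat_def)
    next
      case True
      then have s: "0 < s" "s \<le> 2" "x \<bullet> x \<le> 2" by (simp_all add: s_def)
      have "A \<bullet> outer x \<le> b * 2"
        using A(2) mult_left_mono[OF s(3) assms(2)] by linarith
      then have "2 * (K - 2 * s) * (A \<bullet> outer x) \<le> 2 * K * (b * 2)"
        using A(1) assms s by (intro mult_mono) auto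
      moreover have "0 \<le> 2 * (K - 2 * s) * (A \<bullet> outer x)"
        using A(1) assms s by (intro mult_nonneg_nonneg) auto
      moreover have "s\<^sup>2 * (A \<bullet> mat 1) \<le> 4 * b"
        using power_mono[of s 2 2] s A(3,4) by (intro mult_mono) auto
      moreover have "0 \<le> s\<^sup>2 * (A \<bullet> mat 1)" using A(3) by simp
      moreover have "0 \<le> K * b" using assms by simp
      ultimately have "\<bar>Q\<bar> \<le> 4 * K * b + 4 * b"
        unfolding Q_def using assms(2) by linarith
      moreover have "\<bar>flat K 4 s\<bar> \<le> e" using e s by simp
      ultimately show ?thesis
        unfolding L abs_mult using assms e0 by (intro mult_mono) auto
    qed
  qed
qed

section \<open>Integration\<close>

text \<open>The open ball is a countable union of closed balls on which \<open>v\<close> is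
  integrable, and measurability is glued from these pieces.\<close>

lemma loc_integrable_imp_measurable:
  fixes v :: "real^'n \<Rightarrow> real"
  assumes "loc_integrable (ball 0 r) v"
  shows "v \<in> borel_measurable (lebesgue_on (ball 0 r))"
proof (rule measurable_piecewise_restrict[where C = "range (\<lambda>n::nat. cball 0 (r - 1 / Suc n))"])
  show "space (lebesgue_on (ball 0 r)) \<subseteq> (\<Union>n::nat. cball (0::real^'n) (r - 1 / Suc n))"
  proof
    fix x :: "real^'n" assume "x \<in> space (lebesgue_on (ball 0 r))"
    then have "0 < r - norm x" by simp
    then obtain n where "1 / Suc n < r - norm x" using nat_approx_posE by blast
    then show "x \<in> (\<Union>n::nat. cball 0 (r - 1 / Suc n))"
      by (auto intro!: exI[of _ n])
  qed
next
  fix X :: "(real^'n) set" assume "X \<in> range (\<lambda>n::nat. cball 0 (r - 1 / Suc n))"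
  then obtain n :: nat where X: "X = cball 0 (r - 1 / Suc n)" by auto
  have sub: "X \<subseteq> ball 0 r"
  proof
    fix x assume "x \<in> X"
    then have "norm x \<le> r - 1 / Suc n" by (simp add: X)
    moreover have "0 < 1 / real (Suc n)" by simp
    ultimately show "x \<in> ball 0 r" unfolding mem_ball_0 by linarith
  qed
  then show "X \<inter> space (lebesgue_on (ball 0 r)) \<in> sets (lebesgue_on (ball 0 r))"
    by (auto simp: sets_restrict_space_iff X Int_absorb2)
  have "integrable (lebesgue_on X) v"
    using assms sub by (auto simp: loc_integrable_def X)
  then show "v \<in> borel_measurable (restrict_space (lebesgue_on (ball 0 r)) X)"
    using sub by (subst restrict_restrict_space) (auto simp: X Int_absorb1)
qed simp

lemma L1_norm_subset:
  assumes "S \<subseteq> T" "S \<in> sets lebesgue" "T \<in> sets lebesgue"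
  shows "L1_norm S v = (\<integral>x. indicator S x * \<bar>v x\<bar> \<partial>lebesgue_on T)"
proof -
  have "L1_norm S v = (\<integral>x. indicator S x *\<^sub>R \<bar>v x\<bar> \<partial>lebesgue)"
    using assms(2) by (simp add: L1_norm_def integral_restrict_space)
  also have "\<dots> = (\<integral>x. indicator T x *\<^sub>R (indicator S x * \<bar>v x\<bar>) \<partial>lebesgue)"
    using assms(1) by (intro Bochner_Integration.integral_cong) (auto simp: indicator_def)
  also have "\<dots> = (\<integral>x. indicator S x * \<bar>v x\<bar> \<partial>lebesgue_on T)"
    using assms(3) by (simp add: integral_restrict_space)
  finally show ?thesis .
qed

text \<open>\<open>real_of_ereal\<close> sends both infinities to 0. Boundedness of \<open>f\<close>
  excludes the value plus infinity of the essential supremum, and positive measure of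
  \<open>S\<close> excludes minus infinity, so the conversion loses nothing.\<close>

lemma AE_abs_le_Linf_norm:
  assumes "f \<in> borel_measurable (lebesgue_on S)" "bounded (f ` S)"
    and S: "S \<in> sets lebesgue" "\<not> negligible S"
  shows "AE x in lebesgue_on S. \<bar>f x\<bar> \<le> Linf_norm S f" and "0 \<le> Linf_norm S f"
proof -
  let ?M = "lebesgue_on S"
  define e where "e = esssup ?M (\<lambda>x. ereal \<bar>f x\<bar>)"
  have m: "(\<lambda>x. ereal \<bar>f x\<bar>) \<in> borel_measurable ?M"
    using assms(1) by measurable
  obtain B where B: "\<And>x. x \<in> S \<Longrightarrow> \<bar>f x\<bar> \<le> B"
    using assms(2) by (auto simp: bounded_real)
  have "e \<le> ereal B"
    unfolding e_def by (rule esssup_I[OF m]) (auto intro!: AE_I2 B)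
  moreover have "emeasure ?M (space ?M) \<noteq> 0"
    using S by (auto simp: emeasure_restrict_space negligible_iff_null_sets null_sets_def)
  then have "0 \<le> e"
    using esssup_mono[of "\<lambda>_. 0" ?M "\<lambda>x. ereal \<bar>f x\<bar>"] esssup_const[of ?M "0::ereal"]
    by (simp add: e_def)
  ultimately have e: "e = ereal (Linf_norm S f)"
    unfolding Linf_norm_def e_def[symmetric] by (cases e) auto
  show "0 \<le> Linf_norm S f" using \<open>0 \<le> e\<close> by (simp add: e)
  show "AE x in ?M. \<bar>f x\<bar> \<le> Linf_norm S f"
    using esssup_AE[of "\<lambda>x. ereal \<bar>f x\<bar>" ?M] unfolding e_def[symmetric] e by simp
qed

section \<open>The mass estimate from the barrier\<close>

theorem lemma2:
  fixes nrm :: "real^'n^'n \<Rightarrow> real" and lam Lam :: real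
  assumes "sym_mat_norm nrm" and "0 < lam" and "lam \<le> Lam"
  shows "\<exists>C>0. \<forall>(F :: real^'n^'n \<Rightarrow> real) (u :: real^'n \<Rightarrow> real) (H :: real^'n \<Rightarrow> real^'n^'n)
            (f :: real^'n \<Rightarrow> real) (m :: real^'n \<Rightarrow> real).
      C1_sym F \<longrightarrow> F 0 = 0 \<longrightarrow> elliptic nrm lam Lam F \<longrightarrow>
      u \<in> sobolev_loc 2 (ball 0 2) \<longrightarrow> weak_hessian (ball 0 2) u H \<longrightarrow>
      f \<in> borel_measurable (lebesgue_on (ball 0 2)) \<longrightarrow> bounded (f ` ball 0 2) \<longrightarrow>
      integrable (lebesgue_on (ball 0 2)) m \<longrightarrow> (AE x in lebesgue_on (ball 0 2). 0 \<le> m x) \<longrightarrow>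
      weak_supersolution (ball 0 2) F H m f \<longrightarrow>
      L1_norm (ball 0 1) m \<le> C * L1_norm (ball 0 (1 / 2)) m + C * Linf_norm (ball 0 2) f"
proof -
  obtain a b where a: "0 < a" and b: "0 \<le> b" and
    ab: "\<And>F M (x::real^'n). C1_sym F \<Longrightarrow> elliptic nrm lam Lam F \<Longrightarrow>
      a * (x \<bullet> x) \<le> grad_mat F M \<bullet> outer x \<and> grad_mat F M \<bullet> outer x \<le> b * (x \<bullet> x) \<and>
      0 \<le> grad_mat F M \<bullet> mat 1 \<and> grad_mat F M \<bullet> mat 1 \<le> b"
    using elliptic_quadratic_form_bounds[OF assms] by blast
  define K where "K = 4 + (8 * b + 2) / a"
  have K4: "4 < K" using a b by (simp add: K_def)
  then have K: "0 < K" by simp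
  obtain B where B: "0 \<le> B"
    "\<And>A (x::real^'n). 0 \<le> A \<bullet> outer x \<Longrightarrow> A \<bullet> outer x \<le> b * (x \<bullet> x) \<Longrightarrow>
      0 \<le> A \<bullet> mat 1 \<Longrightarrow> A \<bullet> mat 1 \<le> b \<Longrightarrow> \<bar>barrier_operator K A x\<bar> \<le> B"
    using barrier_operator_bounded[OF K4 b] by blast
  define c where "c = K * exp (- K) / 8"
  have c: "0 < c" using K by (simp add: c_def)
  let ?M = "lebesgue_on (ball (0::real^'n) 2)"
  define V where "V = measure ?M (space ?M)"
  \<comment> \<open>The argument gives \<open>c\<close> times the mass in the unit ball with the
    coefficients \<open>V\<close> and \<open>c + B\<close> on the right; \<open>V + c + B\<close>
    dominates both. All these numbers are fixed before \<open>F\<close>, \<open>u\<close>,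
    \<open>f\<close> and \<open>m\<close>.\<close>
  define C where "C = (V + c + B) / c"
  have V: "0 \<le> V" by (simp add: V_def)
  have "0 < C" using V c B(1) by (simp add: C_def)
  moreover have "L1_norm (ball 0 1) m \<le> C * L1_norm (ball 0 (1 / 2)) m + C * Linf_norm (ball 0 2) f"
    if F: "C1_sym F" "elliptic nrm lam Lam F" and H: "weak_hessian (ball 0 2) u H"
      and f: "f \<in> borel_measurable ?M" "bounded (f ` ball 0 2)"
      and m: "integrable ?M m" "AE x in ?M. 0 \<le> m x"
      and sup: "weak_supersolution (ball 0 2) F H m f"
    for F u H f m
  proof -
    define \<phi> where "\<phi> x = flat K 0 (2 - x \<bullet> x)" for x :: "real^'n"
    define g where "g x = barrier_operator K (grad_mat F (H x)) x" for x
    have \<phi>: "0 \<le> \<phi> x" "\<phi> x \<le> 1" for x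
      using K by (auto simp: \<phi>_def flat_def)
    note A = ab[OF F]
    have A0: "0 \<le> grad_mat F M \<bullet> outer x" for M x
      using A[where M = M and x = x] a by (smt (verit) inner_ge_zero mult_nonneg_nonneg)
    have gB: "\<bar>g x\<bar> \<le> B" for x
      unfolding g_def using A A0 by (intro B(2)) auto
    have g0: "0 \<le> g x" if "1 / 4 \<le> x \<bullet> x" for x
      unfolding g_def using A that by (intro barrier_operator_lower(1)[OF a b K_def]) auto
    have g1: "c \<le> g x" if "1 / 4 \<le> x \<bullet> x" "x \<bullet> x \<le> 1" for x
      unfolding g_def c_def using A that by (intro barrier_operator_lower(2)[OF a b K_def]) auto

    \<comment> \<open>Measurability of the coefficients makes \<open>g x * m x\<close> integrable,
      so that the integral of the sum below can be split.\<close>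
    have Hm: "H \<in> borel_measurable ?M"
    proof (subst borel_measurable_euclidean_space, rule ballI)
      fix E :: "real^'n^'n" assume "E \<in> Basis"
      then obtain i j where "E = axis i (axis j 1)" by (auto simp: Basis_vec_def)
      moreover have "(\<lambda>x. H x $ i $ j) \<in> borel_measurable ?M"
        using H by (intro loc_integrable_imp_measurable) (simp add: weak_hessian_def weak_deriv_def)
      ultimately show "(\<lambda>x. H x \<bullet> E) \<in> borel_measurable ?M"
        by (simp add: inner_axis)
    qed
    have Am: "(\<lambda>x. grad_mat F (H x)) \<in> borel_measurable ?M"
      using measurable_compose[OF Hm borel_measurable_continuous_onI[OF continuous_on_grad_mat[OF F(1)]]] .
    have cont: "h \<in> borel_measurable ?M" if "continuous_on UNIV h" for h :: "real^'n \<Rightarrow> 'b::topological_space"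
      using measurable_compose[OF _ borel_measurable_continuous_onI[OF that], of "\<lambda>x. x" ?M]
      by (simp add: measurable_restrict_space1 measurable_completion)
    have fl: "(\<lambda>x. flat K n (2 - x \<bullet> x)) \<in> borel_measurable ?M" for n
      by (intro cont continuous_on_compose2[OF continuous_on_flat[OF K, of UNIV]] continuous_intros) auto
    have om: "(outer :: real^'n \<Rightarrow> _) \<in> borel_measurable ?M" "(\<lambda>x::real^'n. x \<bullet> x) \<in> borel_measurable ?M"
      unfolding outer_def by (intro cont continuous_intros)+
    have gm: "g \<in> borel_measurable ?M"
      unfolding g_def barrier_operator_def Let_def using fl om Am by measurable
    have int_gm: "integrable ?M (\<lambda>x. g x * m x)"
    proof (rule Bochner_Integration.integrable_bound)
      show "integrable ?M (\<lambda>x. B * m x)" using m(1) by simp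
      show "(\<lambda>x. g x * m x) \<in> borel_measurable ?M" using gm m(1) by measurable
      show "AE x in ?M. norm (g x * m x) \<le> norm (B * m x)"
        using gB B(1) by (auto simp: abs_mult intro!: AE_I2 mult_right_mono)
    qed
    have int_ind: "integrable ?M (\<lambda>x. indicator (ball 0 r) x * \<bar>m x\<bar>)" if "r \<le> 2" for r
      using that m(1) by (intro integrable_mult_indicator[where 'b = real, simplified] integrable_abs)
        (auto simp: sets_restrict_space_iff)
    have L1: "L1_norm (ball 0 r) m = (\<integral>x. indicator (ball 0 r) x * \<bar>m x\<bar> \<partial>?M)" if "r \<le> 2" for r
      using that by (intro L1_norm_subset) auto

    have nn: "\<not> negligible (ball (0::real^'n) 2)"
      by (simp add: open_not_negligible)
    note Linf = AE_abs_le_Linf_norm[OF f _ nn]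
    have Linf0: "0 \<le> Linf_norm (ball 0 2) f" using Linf(2) by simp
    have "(\<integral>x. g x * m x \<partial>?M) \<le> (\<integral>x. f x * \<phi> x \<partial>?M)"
      using sup[unfolded weak_supersolution_def, rule_format, OF flat_test_function[OF K] flat_nonneg]
      by (simp add: sum_second_partials_barrier[OF K] g_def \<phi>_def)
    also have "\<dots> \<le> (\<integral>x. Linf_norm (ball 0 2) f \<partial>?M)"
    proof (rule integral_mono_AE')
      show "integrable ?M (\<lambda>_. Linf_norm (ball 0 2) f)"
        by (intro finite_measure.integrable_const finite_measure_lebesgue_on) simp
      have "AE x in ?M. \<bar>f x\<bar> \<le> Linf_norm (ball 0 2) f" using Linf(1) by simp
      then show "AE x in ?M. f x * \<phi> x \<le> Linf_norm (ball 0 2) f"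
      proof eventually_elim
        case (elim x)
        have "f x * \<phi> x \<le> \<bar>f x\<bar> * 1" using \<phi>[of x] by (intro mult_mono) auto
        then show ?case using elim by simp
      qed
      show "AE x in ?M. 0 \<le> Linf_norm (ball 0 2) f" using Linf0 by simp
    qed
    also have "\<dots> = V * Linf_norm (ball 0 2) f" by (simp add: V_def)
    finally have key: "(\<integral>x. g x * m x \<partial>?M) \<le> V * Linf_norm (ball 0 2) f" .

    have "c * L1_norm (ball 0 1) m = (\<integral>x. c * (indicator (ball 0 1) x * \<bar>m x\<bar>) \<partial>?M)"
      by (simp add: L1)
    \<comment> \<open>In the half ball, \<open>B\<close> absorbs the possibly negative
      \<open>g\<close> and \<open>c\<close> pays for the left side. In the annulus up to radius 1,
      \<open>g\<close> is at least \<open>c\<close>; beyond it, \<open>g\<close> is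
      nonnegative.\<close>
    also have "\<dots> \<le> (\<integral>x. g x * m x + (c + B) * (indicator (ball 0 (1 / 2)) x * \<bar>m x\<bar>) \<partial>?M)"
    proof (rule integral_mono_AE)
      show "AE x in ?M. c * (indicator (ball 0 1) x * \<bar>m x\<bar>) \<le>
          g x * m x + (c + B) * (indicator (ball 0 (1 / 2)) x * \<bar>m x\<bar>)"
        using m(2)
      proof eventually_elim
        case (elim x)
        have sq: "x \<bullet> x = (norm x)\<^sup>2" by (simp add: dot_square_norm)
        consider "norm x < 1 / 2" | "1 / 2 \<le> norm x" "norm x < 1" | "1 \<le> norm x" by linarith
        then show ?case
        proof cases
          case 1
          have "- B * m x \<le> g x * m x"
            using gB[of x] elim by (intro mult_right_mono) auto
          then show ?thesis using 1 elim by (simp add: algebra_simps)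
        next
          case 2
          have "c \<le> g x"
            using 2 power_mono[of "1 / 2" "norm x" 2] power_mono[of "norm x" 1 2]
            by (intro g1) (simp_all add: sq power2_eq_square)
          then show ?thesis using 2 elim by (simp add: mult_right_mono)
        next
          case 3
          have "0 \<le> g x"
            using 3 power_mono[of "1 / 2" "norm x" 2] by (intro g0) (simp add: sq power2_eq_square)
          then show ?thesis using 3 elim by simp
        qed
      qed
    qed (use int_gm int_ind in auto)
    also have "\<dots> = (\<integral>x. g x * m x \<partial>?M) + (c + B) * L1_norm (ball 0 (1 / 2)) m"
      using int_gm int_ind by (simp add: L1)
    also have "\<dots> \<le> V * Linf_norm (ball 0 2) f + (c + B) * L1_norm (ball 0 (1 / 2)) m"
      using key by simp
    also have "\<dots> \<le> (V + c + B) * Linf_norm (ball 0 2) f + (V + c + B) * L1_norm (ball 0 (1 / 2)) m"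
      using c B(1) V Linf0 by (intro add_mono mult_right_mono) (auto simp: L1_norm_def)
    also have "\<dots> = c * (C * L1_norm (ball 0 (1 / 2)) m + C * Linf_norm (ball 0 2) f)"
      using c by (simp add: C_def distrib_left add.commute)
    finally show ?thesis
      using c by (simp only: mult_le_cancel_left_pos)
  qed
  ultimately show ?thesis by blast
qed

end
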